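(* Let $n\ge1$ and let $f=(f_1,\ldots,f_n):\mathbb{R}^n\to\mathbb{R}^n$ be a polynomial map whose Jacobian matrix $J(f)(x)$ does not have $1$ as an eigenvalue at any point $x\in\mathbb{R}^n$ (for example, $J(f)$ is nilpotent). If the leading forms of the components $f_1,\ldots,f_n$ of $f$ all have degrees greater than $1$ and have no common non-trivial zero, then $f$ has a unique fixed point.
   Context: The leading form of a polynomial $f_i$ of total degree $d_i$ is its homogeneous part of degree $d_i$. A common non-trivial zero is a point of $\mathbb{R}^n\setminus\{0\}$ at which all the leading forms vanish. *)

theory Defs
  imports "HOL-Analysis.Analysis" "HOL-Library.Poly_Mapping"
begin

text \<open>
  A polynomial in variables indexed by \<open>'v\<close> is a finitely supported map from monomials to
  coefficients, a monomial being a finitely supported map from variables to exponents.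
\<close>

type_synonym 'v monom = "'v \<Rightarrow>\<^sub>0 nat"
type_synonym ('v, 'a) mpoly = "'v monom \<Rightarrow>\<^sub>0 'a"

definition monom_degree :: "'v monom \<Rightarrow> nat" where
  "monom_degree m = (\<Sum>v\<in>Poly_Mapping.keys m. Poly_Mapping.lookup m v)"

definition mpoly_eval :: "('n::finite, real) mpoly \<Rightarrow> real ^ 'n \<Rightarrow> real" where
  "mpoly_eval p x =
     (\<Sum>m\<in>Poly_Mapping.keys p.
        Poly_Mapping.lookup p m * (\<Prod>i\<in>UNIV. (x $ i) ^ Poly_Mapping.lookup m i))"

text \<open>
  The element \<open>0\<close> only gives the zero polynomial a degree, namely \<open>0\<close>; it does not change the
  maximum for a nonzero polynomial.
\<close>

definition total_degree :: "('v, 'a::zero) mpoly \<Rightarrow> nat" where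
  "total_degree p = Max (insert 0 (monom_degree ` Poly_Mapping.keys p))"

definition homogeneous_part :: "nat \<Rightarrow> ('v, 'a::comm_monoid_add) mpoly \<Rightarrow> ('v, 'a) mpoly" where
  "homogeneous_part d p =
     (\<Sum>m | m \<in> Poly_Mapping.keys p \<and> monom_degree m = d.
        Poly_Mapping.single m (Poly_Mapping.lookup p m))"

definition leading_form :: "('v, 'a::comm_monoid_add) mpoly \<Rightarrow> ('v, 'a) mpoly" where
  "leading_form p = homogeneous_part (total_degree p) p"

definition eigenvalue :: "'a::field ^ 'n::finite ^ 'n \<Rightarrow> 'a \<Rightarrow> bool" where
  "eigenvalue A c \<longleftrightarrow> (\<exists>v. v \<noteq> 0 \<and> A *v v = c *s v)"

end

theory Submission
  imports Defs
begin

text \<open>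
  Fixed points of \<open>f\<close> are zeros of \<open>g x = f x - x\<close>, and \<open>g\<close> is in fact a bijection.

  Since \<open>1\<close> is never an eigenvalue of the Jacobian of \<open>f\<close>, the derivative of \<open>g\<close> is everywhere
  invertible, so \<open>g\<close> is a local homeomorphism. Along a ray in direction \<open>u\<close> the \<open>i\<close>-th component
  of \<open>f\<close> grows like \<open>r ^ d\<^sub>i\<close> times its leading form at \<open>u\<close>. The leading forms have no common
  zero on the unit sphere, hence are bounded away from zero there by compactness; because every
  \<open>d\<^sub>i\<close> exceeds \<open>1\<close>, subtracting the identity changes none of the leading terms. Therefore
  \<open>\<bar>g x\<bar>\<close> tends to infinity with \<open>\<bar>x\<bar>\<close>
  (\<open>filterlim_mpoly_map_minus_id_at_infinity\<close>), that is, \<open>g\<close> is proper.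

  The rest is Hadamard's global inverse function theorem (\<open>Hadamard_global_inverse\<close>). A proper
  local homeomorphism has open and closed image, so it is onto; its fibres are finite, and it is a
  covering map. As Euclidean space is simply connected, every such covering is one-sheeted.
\<close>

section \<open>The global inverse function theorem\<close>

text \<open>
  A fibre is compact and discrete, hence finite. Disjoint charts around its points give the sheets
  over every neighbourhood of \<open>y\<close> whose preimage lies in the union of these charts, and
  properness provides such a neighbourhood.
\<close>

lemma proper_local_homeomorphism_imp_covering_space:
  fixes g :: "'a::metric_space \<Rightarrow> 'b::heine_borel"
  assumes contg: "continuous_on UNIV g"
    and loc: "\<And>x. \<exists>U V h. open U \<and> x \<in> U \<and> open V \<and> homeomorphism U V g h"
    and proper: "\<And>K. compact K \<Longrightarrow> compact (g -` K)"
    and surj: "surj g"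
  shows "covering_space UNIV g UNIV"
proof (rule covering_spaceI)
  fix y :: 'b
  obtain U V h where U: "\<And>x. open (U x)" "\<And>x. x \<in> U x" "\<And>x. open (V x)"
      "\<And>x. homeomorphism (U x) (V x) g (h x)"
    using loc by metis
  have injU: "inj_on g (U x)" for x
    by (metis U(4) homeomorphism_def inj_on_inverseI)
  define F where "F = g -` {y}"
  \<comment> \<open>The fibre is compact, and each chart meets it in one point only.\<close>
  have FU: "F \<inter> U x \<subseteq> {x}" if "x \<in> F" for x
    using injU[of x] U(2)[of x] that by (auto simp: F_def inj_on_def)
  have "compact F"
    unfolding F_def by (rule proper) simp
  then obtain C where C: "C \<subseteq> F" "finite C" "F \<subseteq> (\<Union>x\<in>C. U x)"
    by (rule compactE_image[where C = F and f = U]) (use U in auto)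
  have finF: "finite F"
  proof (rule finite_subset)
    show "F \<subseteq> C" using FU C by blast
  qed (use C in simp)
  obtain e where e: "e > 0" "\<And>x z. x \<in> F \<Longrightarrow> z \<in> F \<Longrightarrow> x \<noteq> z \<Longrightarrow> e \<le> dist x z"
  proof -
    let ?D = "insert 1 ((\<lambda>(x, z). dist x z) ` {(x, z) \<in> F \<times> F. x \<noteq> z})"
    have "finite ?D"
      using finF by (intro finite.insertI finite_imageI) (rule finite_subset[of _ "F \<times> F"], auto)
    show ?thesis
    proof (rule that[of "Min ?D"])
      show "0 < Min ?D" using \<open>finite ?D\<close> by (subst Min_gr_iff) auto
      show "Min ?D \<le> dist x z" if "x \<in> F" "z \<in> F" "x \<noteq> z" for x z
        by (rule Min_le[OF \<open>finite ?D\<close>]) (use that in auto)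
    qed
  qed
  define W where "W x = U x \<inter> ball x (e / 2)" for x
  have W: "open (W x)" "W x \<subseteq> U x" for x
    using U(1) by (auto simp: W_def)
  have xW: "x \<in> W x" for x
    using U(2) e(1) by (simp add: W_def)
  have disW: "disjnt (W x) (W z)" if "x \<in> F" "z \<in> F" "x \<noteq> z" for x z
  proof -
    have False if "w \<in> W x" "w \<in> W z" for w
    proof -
      have "dist x z \<le> dist x w + dist z w" by (rule dist_triangle2)
      also have "\<dots> < e" using that by (auto simp: W_def)
      finally show False using e(2) \<open>x \<in> F\<close> \<open>z \<in> F\<close> \<open>x \<noteq> z\<close> by force
    qed
    then show ?thesis by (auto simp: disjnt_def)
  qed
  have gW: "open (g ` W x)" for x
  proof -
    have "openin (top_of_set (U x)) (W x)"
      using W by (simp add: openin_open_eq[OF U(1)])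
    from homeomorphism_imp_open_map[OF U(4) this] show ?thesis
      by (simp add: openin_open_eq[OF U(3)])
  qed
  \<comment> \<open>Away from the fibre, properness keeps the values of \<open>g\<close> at a positive distance from \<open>y\<close>.\<close>
  define N where "N = (\<Union>x\<in>F. W x)"
  define K where "K = g ` (g -` cball y 1 - N)"
  have "open N" using W by (auto simp: N_def)
  then have "compact (g -` cball y 1 - N)"
    by (intro compact_diff proper compact_cball)
  then have "compact K"
    unfolding K_def using contg by (meson compact_continuous_image continuous_on_subset subset_UNIV)
  then have "closed K" by (rule compact_imp_closed)
  have yK: "y \<notin> K"
    using xW by (auto simp: K_def N_def F_def)
  define T where "T = (\<Inter>x\<in>F. g ` W x) \<inter> ball y 1 - K"
  have "open T"
    unfolding T_def using finF gW \<open>closed K\<close> by (intro open_Diff open_Int open_INT) auto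
  have "y \<in> T"
    using xW yK by (auto simp: T_def F_def)
  have TN: "g -` T \<subseteq> N"
    by (auto simp: T_def K_def)
  define v where "v = (\<lambda>x. W x \<inter> g -` T) ` F"
  have opv: "open (W x \<inter> g -` T)" for x
    using W(1) \<open>open T\<close> contg by (intro open_Int open_vimage) auto
  have hom: "homeomorphism (W x \<inter> g -` T) T g (h x)" if "x \<in> F" for x
  proof (rule homeomorphism_of_subsets[OF U(4)[of x]])
    show "W x \<inter> g -` T \<subseteq> U x" using W by auto
    have "T \<subseteq> g ` W x" using that by (auto simp: T_def)
    then show "g ` (W x \<inter> g -` T) = T" by auto
    have "T \<subseteq> g ` U x"
      using \<open>T \<subseteq> g ` W x\<close> image_mono[OF W(2)] by (rule order_trans)
    then show "T \<subseteq> V x"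
      by (simp add: homeomorphism_image1[OF U(4)])
  qed
  show "\<exists>T. y \<in> T \<and> openin (top_of_set UNIV) T \<and>
        (\<exists>v. \<Union> v = UNIV \<inter> g -` T \<and> (\<forall>u\<in>v. openin (top_of_set UNIV) u) \<and>
             pairwise disjnt v \<and> (\<forall>u\<in>v. \<exists>q. homeomorphism u T g q))"
  proof (intro exI[of _ T] exI[of _ v] conjI)
    show "\<Union> v = UNIV \<inter> g -` T" using TN by (auto simp: v_def N_def)
    show "pairwise disjnt v"
      using disW by (fastforce simp: v_def pairwise_def disjnt_def)
    show "\<forall>u\<in>v. openin (top_of_set UNIV) u" using opv by (auto simp: v_def)
    show "\<forall>u\<in>v. \<exists>q. homeomorphism u T g q" using hom by (auto simp: v_def)
  qed (use \<open>y \<in> T\<close> \<open>open T\<close> in auto)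
qed (use assms in auto)

text \<open>
  The image is open and closed in the connected target, which gives surjectivity. For
  injectivity, the identity of the simply connected target lifts through the covering to a continuous section \<open>s\<close> with \<open>s (g a) = a\<close>. Then \<open>s \<circ> g\<close> and
  the identity are two lifts of \<open>g\<close> that agree at \<open>a\<close>, so they agree everywhere.
\<close>

lemma proper_local_homeomorphism_imp_bij:
  fixes g :: "'a::euclidean_space \<Rightarrow> 'b::euclidean_space"
  assumes contg: "continuous_on UNIV g"
    and loc: "\<And>x. \<exists>U V h. open U \<and> x \<in> U \<and> open V \<and> homeomorphism U V g h"
    and proper: "\<And>K. compact K \<Longrightarrow> compact (g -` K)"
  shows "bij g"
proof -
  have "open (range g)"
  proof (subst open_subopen, intro ballI)
    fix y assume "y \<in> range g"
    then obtain x where "y = g x" by auto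
    moreover obtain U V h where "x \<in> U" "open V" "homeomorphism U V g h"
      using loc by blast
    ultimately show "\<exists>T. open T \<and> y \<in> T \<and> T \<subseteq> range g"
      unfolding homeomorphism_def by blast
  qed
  moreover have "closed (range g)"
  proof -
    have "y \<in> range g" if "y \<in> closure (range g)" for y
    proof -
      let ?K = "g ` (g -` cball y 1)"
      have "compact ?K"
        using contg proper[OF compact_cball]
        by (meson compact_continuous_image continuous_on_subset subset_UNIV)
      then have "closed ?K" by (rule compact_imp_closed)
      have "y \<in> closure (ball y 1 \<inter> range g)"
        using that open_Int_closure_subset[of "ball y 1" "range g"] by auto
      also have "\<dots> \<subseteq> ?K"
        by (rule closure_minimal[OF _ \<open>closed ?K\<close>]) auto
      finally show ?thesis by auto
    qed
    then show ?thesis by (meson closure_subset_eq subsetI)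
  qed
  ultimately have surj: "surj g"
    using clopen[of "range g"] by auto
  have cov: "covering_space UNIV g UNIV"
    by (rule proper_local_homeomorphism_imp_covering_space[OF assms surj])
  have "inj g"
  proof (rule injI)
    fix a b assume ab: "g a = g b"
    obtain s where s: "continuous_on UNIV s" "s (g a) = a" "\<And>y. g (s y) = y"
    proof (rule covering_space_lift_strong[OF cov, of a "g a" UNIV "\<lambda>y. y"])
      show "simply_connected (UNIV :: 'b set)"
        by (simp add: convex_imp_simply_connected)
      show "locally path_connected (UNIV :: 'b set)"
        by (simp add: convex_imp_locally_path_connected)
    qed (auto intro: continuous_intros)
    have contsg: "continuous_on UNIV (\<lambda>x. s (g x))"
      using s(1) contg by (rule continuous_on_compose2) simp
    have "s (g b) = b"
    proof (rule covering_space_lift_unique)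
      show "covering_space UNIV g UNIV" by (rule cov)
      show "s (g a) = a" by (rule s(2))
      show "g x = g (s (g x))" for x by (simp only: s(3))
      show "continuous_on UNIV (\<lambda>x. s (g x))" by (rule contsg)
    qed (use contg in auto)
    then show "a = b"
      unfolding ab[symmetric] s(2) .
  qed
  with surj show ?thesis by (simp add: bij_def)
qed

text \<open>
  The inverse function theorem supplies the local homeomorphisms, and the growth of \<open>g\<close> at infinity
  makes preimages of bounded sets bounded.
\<close>

lemma Hadamard_global_inverse:
  fixes g :: "'a::euclidean_space \<Rightarrow> 'a"
  assumes der: "\<And>x. (g has_derivative g' x) (at x)"
    and cont: "\<And>h. continuous_on UNIV (\<lambda>x. g' x h)"
    and inj: "\<And>x h. g' x h = 0 \<Longrightarrow> h = 0"
    and lim: "filterlim g at_infinity at_infinity"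
  shows "bij g"
proof (rule proper_local_homeomorphism_imp_bij)
  show contg: "continuous_on UNIV g"
    using der has_derivative_continuous by (blast intro: continuous_at_imp_continuous_on)
  have lin: "bounded_linear (g' x)" for x
    using der by (rule has_derivative_bounded_linear)
  show "\<exists>U V h. open U \<and> x \<in> U \<and> open V \<and> homeomorphism U V g h" for x
  proof -
    have ap: "blinfun_apply (Blinfun (g' z)) = g' z" for z
      by (rule bounded_linear_Blinfun_apply[OF lin])
    have "inj (g' x)"
      using inj linear_injective_0[OF bounded_linear.linear[OF lin]] by blast
    then obtain k where k: "linear k" "k \<circ> g' x = id"
      using linear_injective_left_inverse[OF bounded_linear.linear[OF lin]] by blast
    have kap: "blinfun_apply (Blinfun k) = k"
      using k(1) by (simp add: bounded_linear_Blinfun_apply linear_conv_bounded_linear)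
    show ?thesis
    proof (rule inverse_function_theorem[of UNIV g "\<lambda>z. Blinfun (g' z)" x "Blinfun k"])
      show "continuous_on UNIV (\<lambda>z. Blinfun (g' z))"
        using cont by (intro continuous_on_blinfun_componentwise) (simp add: ap)
      show "Blinfun k o\<^sub>L Blinfun (g' x) = id_blinfun"
        using k(2) by (intro blinfun_eqI) (simp add: ap kap o_def fun_eq_iff)
    qed (use der in \<open>auto simp: ap\<close>)
  qed
  show "compact (g -` K)" if K: "compact K" for K
  proof -
    obtain R where R: "\<And>y. y \<in> K \<Longrightarrow> norm y < R"
      using compact_imp_bounded[OF K] unfolding bounded_pos_less by blast
    have "\<forall>\<^sub>F x in at_infinity. R \<le> norm (g x)"
      using lim by (simp add: filterlim_at_infinity_conv_norm_at_top filterlim_at_top)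
    then obtain b where "\<And>x. b \<le> norm x \<Longrightarrow> R \<le> norm (g x)"
      unfolding eventually_at_infinity by blast
    with R have "\<And>x. x \<in> g -` K \<Longrightarrow> norm x \<le> b"
      by (metis linorder_not_le less_imp_le vimageD)
    then have "bounded (g -` K)" by (auto simp: bounded_iff)
    moreover have "closed (g -` K)"
      using contg compact_imp_closed[OF K] by (simp add: closed_vimage)
    ultimately show ?thesis by (simp add: compact_eq_bounded_closed)
  qed
qed

section \<open>Growth of polynomial maps at infinity\<close>

definition monom_eval :: "'n::finite monom \<Rightarrow> real ^ 'n \<Rightarrow> real" where
  "monom_eval m x = (\<Prod>i\<in>UNIV. (x $ i) ^ Poly_Mapping.lookup m i)"

definition monom_deriv :: "'n::finite monom \<Rightarrow> real ^ 'n \<Rightarrow> real ^ 'n \<Rightarrow> real" where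
  "monom_deriv m x h =
     (\<Sum>i\<in>UNIV. of_nat (Poly_Mapping.lookup m i) * h $ i * (x $ i) ^ (Poly_Mapping.lookup m i - 1)
        * (\<Prod>j\<in>UNIV - {i}. (x $ j) ^ Poly_Mapping.lookup m j))"

definition mpoly_deriv :: "('n::finite, real) mpoly \<Rightarrow> real ^ 'n \<Rightarrow> real ^ 'n \<Rightarrow> real" where
  "mpoly_deriv p x h =
     (\<Sum>m\<in>Poly_Mapping.keys p. Poly_Mapping.lookup p m * monom_deriv m x h)"

lemma mpoly_eval_monom_eval:
  "mpoly_eval p x = (\<Sum>m\<in>Poly_Mapping.keys p. Poly_Mapping.lookup p m * monom_eval m x)"
  by (simp add: mpoly_eval_def monom_eval_def)

lemma has_derivative_monom_eval: "(monom_eval m has_derivative monom_deriv m x) (at x)"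
proof -
  have "((\<lambda>x. (x $ i) ^ k) has_derivative (\<lambda>h. of_nat k * h $ i * (x $ i) ^ (k - 1))) (at x)"
    for i k
    by (intro has_derivative_power bounded_linear.has_derivative[OF bounded_linear_vec_nth]
        has_derivative_ident)
  from has_derivative_prod[where I = UNIV, OF this] show ?thesis
    unfolding monom_eval_def[abs_def] monom_deriv_def[abs_def] .
qed

lemma has_derivative_mpoly_eval: "(mpoly_eval p has_derivative mpoly_deriv p x) (at x)"
  unfolding mpoly_eval_monom_eval[abs_def] mpoly_deriv_def[abs_def]
  by (intro has_derivative_sum has_derivative_mult_right has_derivative_monom_eval)

lemma continuous_on_mpoly_deriv: "continuous_on S (\<lambda>x. mpoly_deriv p x h)"
  unfolding mpoly_deriv_def monom_deriv_def by (intro continuous_intros)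

lemma continuous_on_mpoly_eval: "continuous_on S (mpoly_eval p)"
  unfolding mpoly_eval_def[abs_def] by (intro continuous_intros)

lemma monom_degree_eq_sum_UNIV:
  fixes m :: "'n::finite monom"
  shows "monom_degree m = (\<Sum>i\<in>UNIV. Poly_Mapping.lookup m i)"
  unfolding monom_degree_def
  by (rule sum.mono_neutral_left) (auto simp: in_keys_iff)

lemma monom_eval_scaleR: "monom_eval m (c *\<^sub>R x) = c ^ monom_degree m * monom_eval m x"
  by (simp add: monom_eval_def monom_degree_eq_sum_UNIV power_mult_distrib prod.distrib power_sum)

lemma abs_monom_eval_le: "\<bar>monom_eval m x\<bar> \<le> norm x ^ monom_degree m"
proof -
  have "\<bar>monom_eval m x\<bar> = (\<Prod>i\<in>UNIV. \<bar>x $ i\<bar> ^ Poly_Mapping.lookup m i)"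
    by (simp add: monom_eval_def abs_prod power_abs)
  also have "\<dots> \<le> (\<Prod>i\<in>UNIV. norm x ^ Poly_Mapping.lookup m i)"
    by (intro prod_mono conjI power_mono component_le_norm_cart) auto
  also have "\<dots> = norm x ^ monom_degree m"
    by (simp add: monom_degree_eq_sum_UNIV power_sum)
  finally show ?thesis .
qed

lemma lookup_homogeneous_part:
  "Poly_Mapping.lookup (homogeneous_part d p) m =
     (if monom_degree m = d then Poly_Mapping.lookup p m else 0)"
proof -
  have "Poly_Mapping.lookup (homogeneous_part d p) m =
      (\<Sum>k | k \<in> Poly_Mapping.keys p \<and> monom_degree k = d.
        if k = m then Poly_Mapping.lookup p k else 0)"
    by (auto simp: homogeneous_part_def lookup_sum lookup_single when_def intro: sum.cong)
  then show ?thesis by (simp add: in_keys_iff)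
qed

lemma keys_homogeneous_part:
  "Poly_Mapping.keys (homogeneous_part d p) = {m \<in> Poly_Mapping.keys p. monom_degree m = d}"
  by (auto simp: in_keys_iff lookup_homogeneous_part split: if_splits)

lemma monom_degree_le_total_degree:
  "m \<in> Poly_Mapping.keys p \<Longrightarrow> monom_degree m \<le> total_degree p"
  by (simp add: total_degree_def)

lemma total_degree_leading_form_le: "total_degree (leading_form p) \<le> total_degree p"
proof -
  have "Poly_Mapping.keys (leading_form p) \<subseteq> Poly_Mapping.keys p"
    by (auto simp: leading_form_def keys_homogeneous_part)
  then show ?thesis
    unfolding total_degree_def by (intro Max_mono) auto
qed

lemma mpoly_eval_homogeneous_part:
  "mpoly_eval (homogeneous_part d p) x =
     (\<Sum>m\<in>Poly_Mapping.keys p.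
        if monom_degree m = d then Poly_Mapping.lookup p m * monom_eval m x else 0)"
  by (simp add: mpoly_eval_monom_eval keys_homogeneous_part lookup_homogeneous_part
      sum.inter_filter)

lemma tendsto_inverse_norm_at_infinity:
  "((\<lambda>x::'a::real_normed_vector. inverse (norm x)) \<longlongrightarrow> 0) at_infinity"
  by (rule tendsto_inverse_0_at_top[OF filterlim_norm_at_top])

text \<open>
  After division by \<open>norm x ^ d\<close>, a monomial of degree \<open>d\<close> depends on the direction of \<open>x\<close> only,
  while one of smaller degree is at most \<open>1 / norm x\<close> once \<open>norm x \<ge> 1\<close>.
\<close>

lemma tendsto_monom_eval_minus_homogeneous:
  assumes "monom_degree m \<le> d"
  shows "((\<lambda>x. monom_eval m x / norm x ^ d
      - (if monom_degree m = d then monom_eval m (x /\<^sub>R norm x) else 0)) \<longlongrightarrow> 0) at_infinity"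
proof (rule Lim_null_comparison[OF _ tendsto_inverse_norm_at_infinity])
  have "\<forall>\<^sub>F x :: real^'a in at_infinity. 1 \<le> norm x"
    unfolding eventually_at_infinity by blast
  then show "\<forall>\<^sub>F x in at_infinity. norm (monom_eval m x / norm x ^ d
      - (if monom_degree m = d then monom_eval m (x /\<^sub>R norm x) else 0)) \<le> inverse (norm x)"
  proof eventually_elim
    case (elim x)
    then have x: "norm x > 0" by linarith
    show ?case
    proof (cases "monom_degree m = d")
      case True
      then show ?thesis by (simp add: monom_eval_scaleR field_simps)
    next
      case False
      have "\<bar>monom_eval m x\<bar> * norm x \<le> norm x ^ monom_degree m * norm x"
        by (intro mult_right_mono abs_monom_eval_le) simp
      also have "\<dots> = norm x ^ Suc (monom_degree m)" by simp
      also have "\<dots> \<le> norm x ^ d"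
        using elim assms False by (intro power_increasing) auto
      finally show ?thesis using False x by (simp add: field_simps)
    qed
  qed
qed

lemma tendsto_mpoly_eval_minus_leading_form:
  "((\<lambda>x. mpoly_eval p x / norm x ^ total_degree p - mpoly_eval (leading_form p) (x /\<^sub>R norm x))
     \<longlongrightarrow> 0) at_infinity"
proof -
  let ?d = "total_degree p"
  have "((\<lambda>x. \<Sum>m\<in>Poly_Mapping.keys p. Poly_Mapping.lookup p m * (monom_eval m x / norm x ^ ?d
      - (if monom_degree m = ?d then monom_eval m (x /\<^sub>R norm x) else 0))) \<longlongrightarrow> 0) at_infinity"
    by (intro tendsto_null_sum tendsto_mult_right_zero tendsto_monom_eval_minus_homogeneous
        monom_degree_le_total_degree)
  moreover have "mpoly_eval p x / norm x ^ ?d - mpoly_eval (leading_form p) (x /\<^sub>R norm x) =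
      (\<Sum>m\<in>Poly_Mapping.keys p. Poly_Mapping.lookup p m * (monom_eval m x / norm x ^ ?d
        - (if monom_degree m = ?d then monom_eval m (x /\<^sub>R norm x) else 0)))" for x
    unfolding leading_form_def mpoly_eval_homogeneous_part mpoly_eval_monom_eval[of p]
      sum_divide_distrib sum_subtractf[symmetric]
    by (intro sum.cong) (auto simp: algebra_simps)
  ultimately show ?thesis by simp
qed

text \<open>
  The components may have different degrees, so each is rescaled by its own power of \<open>norm x\<close>.
  The rescaled map \<open>G\<close> is asymptotic to the vector \<open>L\<close> of leading forms at the direction of \<open>x\<close>,
  which has norm at least some \<open>c > 0\<close>. Since all degrees are at least \<open>1\<close>, undoing the rescaling
  yields \<open>norm (f x - x) \<ge> c / 2 * norm x\<close> for large \<open>x\<close>.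
\<close>

lemma filterlim_mpoly_map_minus_id_at_infinity:
  fixes f :: "real ^ 'n \<Rightarrow> real ^ 'n"
    and p :: "'n::finite \<Rightarrow> ('n, real) mpoly"
  assumes f: "\<And>x i. f x $ i = mpoly_eval (p i) x"
    and deg: "\<And>i. total_degree (p i) > 1"
    and zero: "\<And>x. (\<And>i. mpoly_eval (leading_form (p i)) x = 0) \<Longrightarrow> x = 0"
  shows "filterlim (\<lambda>x. f x - x) at_infinity at_infinity"
proof -
  define L where "L x = (\<chi> i. mpoly_eval (leading_form (p i)) x)" for x
  define G where "G x = (\<chi> i. (f x - x) $ i / norm x ^ total_degree (p i))" for x
  have "continuous_on (sphere 0 1) L"
    unfolding L_def[abs_def] by (intro continuous_on_vec_lambda continuous_on_mpoly_eval)
  then have "continuous_on (sphere 0 1) (\<lambda>u. norm (L u))"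
    by (rule continuous_on_norm)
  moreover have "sphere (0 :: real ^ 'n) 1 \<noteq> {}" by simp
  ultimately obtain u :: "real ^ 'n" where u: "u \<in> sphere 0 1"
      "\<And>w. w \<in> sphere 0 1 \<Longrightarrow> norm (L u) \<le> norm (L w)"
    using continuous_attains_inf[OF compact_sphere] by metis
  define c where "c = norm (L u)"
  have "L u \<noteq> 0"
  proof
    assume "L u = 0"
    then have "u = 0" by (intro zero) (simp add: L_def vec_eq_iff)
    with u(1) show False by simp
  qed
  then have "c > 0" by (simp add: c_def)
  have "((\<lambda>x. G x - L (x /\<^sub>R norm x)) \<longlongrightarrow> 0) at_infinity"
  proof (rule vec_tendstoI)
    fix i
    let ?d = "total_degree (p i)"
    \<comment> \<open>The subtracted identity disappears in the limit because \<open>?d\<close> is at least \<open>2\<close>.\<close>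
    have "((\<lambda>x :: real ^ 'n. x $ i / norm x ^ ?d) \<longlongrightarrow> 0) at_infinity"
    proof (rule Lim_null_comparison[OF _ tendsto_inverse_norm_at_infinity])
      have "\<forall>\<^sub>F x :: real^'n in at_infinity. 1 \<le> norm x"
        unfolding eventually_at_infinity by blast
      then show "\<forall>\<^sub>F x :: real^'n in at_infinity. norm (x $ i / norm x ^ ?d) \<le> inverse (norm x)"
      proof eventually_elim
        case (elim x)
        have "\<bar>x $ i\<bar> * norm x \<le> norm x ^ 2"
          by (simp add: power2_eq_square mult_right_mono component_le_norm_cart)
        also have "\<dots> \<le> norm x ^ ?d"
          using elim deg[of i] by (intro power_increasing) auto
        finally show ?case
          using less_le_trans[OF zero_less_one elim] by (simp add: field_simps)
      qed
    qed
    from tendsto_diff[OF tendsto_mpoly_eval_minus_leading_form[of "p i"] this]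
    show "((\<lambda>x. (G x - L (x /\<^sub>R norm x)) $ i) \<longlongrightarrow> 0 $ i) at_infinity"
      by (simp add: G_def L_def f diff_divide_distrib algebra_simps)
  qed
  then have "\<forall>\<^sub>F x in at_infinity. norm (G x - L (x /\<^sub>R norm x)) < c / 2"
    using \<open>c > 0\<close> unfolding tendsto_iff dist_norm diff_zero by (meson half_gt_zero)
  moreover have "\<forall>\<^sub>F x :: real^'n in at_infinity. 1 \<le> norm x"
    unfolding eventually_at_infinity by blast
  ultimately have "\<forall>\<^sub>F x in at_infinity. c / 2 * norm x \<le> norm (f x - x)"
  proof eventually_elim
    case (elim x)
    have "c \<le> norm (L (x /\<^sub>R norm x))"
    proof -
      have "x \<noteq> 0" using elim by auto
      then show ?thesis unfolding c_def by (intro u(2)) simp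
    qed
    also have "\<dots> \<le> norm (G x) + norm (G x - L (x /\<^sub>R norm x))"
      by norm
    finally have "c / 2 * norm x \<le> norm (G x) * norm x"
      using elim by (intro mult_right_mono) auto
    also have "\<dots> = norm (norm x *\<^sub>R G x)" by simp
    also have "\<dots> \<le> norm (f x - x)"
    proof (rule norm_le_componentwise_cart)
      fix i
      have "norm x \<le> norm x ^ total_degree (p i)"
        using elim deg[of i] power_increasing[of 1 "total_degree (p i)" "norm x"] by simp
      then have "\<bar>(f x - x) $ i\<bar> * norm x \<le> \<bar>(f x - x) $ i\<bar> * norm x ^ total_degree (p i)"
        by (intro mult_left_mono) auto
      moreover have "0 < norm x ^ total_degree (p i)"
        using elim by (intro zero_less_power) linarith
      ultimately have "\<bar>(f x - x) $ i\<bar> * norm x / norm x ^ total_degree (p i) \<le> \<bar>(f x - x) $ i\<bar>"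
        by (simp only: pos_divide_le_eq)
      then show "norm ((norm x *\<^sub>R G x) $ i) \<le> norm ((f x - x) $ i)"
        by (simp add: G_def abs_mult mult.commute)
    qed
    finally show ?case .
  qed
  moreover have "filterlim (\<lambda>x :: real ^ 'n. c / 2 * norm x) at_top at_infinity"
    using \<open>c > 0\<close> by (intro filterlim_tendsto_pos_mult_at_top[OF tendsto_const] filterlim_norm_at_top) auto
  ultimately show ?thesis
    unfolding filterlim_at_infinity_conv_norm_at_top by (rule filterlim_at_top_mono[rotated])
qed

section \<open>Unique fixed points of polynomial maps\<close>

theorem theorem12p1:
  fixes f :: "real ^ 'n \<Rightarrow> real ^ 'n"
    and p :: "'n::finite \<Rightarrow> ('n, real) mpoly"
  assumes "\<And>x i. f x $ i = mpoly_eval (p i) x"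
    and "\<And>x. \<not> eigenvalue (jacobian f (at x)) 1"
    and "\<And>i. total_degree (leading_form (p i)) > 1"
    and "\<not> (\<exists>x. x \<noteq> 0 \<and> (\<forall>i. mpoly_eval (leading_form (p i)) x = 0))"
  shows "\<exists>!x. f x = x"
proof -
  define f' where "f' x h = (\<chi> i. mpoly_deriv (p i) x h)" for x h
  have f_eq: "f = (\<lambda>x. \<chi> i. mpoly_eval (p i) x)"
    using assms(1) by (simp add: fun_eq_iff vec_eq_iff)
  have der: "(f has_derivative f' x) (at x)" for x
    unfolding f_eq f'_def[abs_def]
    by (subst has_derivative_componentwise_within)
      (auto simp: Basis_vec_def inner_axis intro: has_derivative_mpoly_eval)
  have "bij (\<lambda>x. f x - x)"
  proof (rule Hadamard_global_inverse)
    show "((\<lambda>x. f x - x) has_derivative (\<lambda>h. f' x h - h)) (at x)" for x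
      by (intro derivative_intros der)
    show "continuous_on UNIV (\<lambda>x. f' x h - h)" for h
      unfolding f'_def
      by (intro continuous_intros continuous_on_vec_lambda continuous_on_mpoly_deriv)
    show "h = 0" if "f' x h - h = 0" for x h
    proof -
      have "f differentiable (at x)" using der by (auto simp: differentiable_def)
      then have "(f has_derivative (\<lambda>h. jacobian f (at x) *v h)) (at x)"
        by (simp add: jacobian_works)
      then have "jacobian f (at x) *v h = f' x h"
        using has_derivative_unique[OF der] by metis
      with that have "jacobian f (at x) *v h = 1 *s h" by simp
      with assms(2)[of x] show ?thesis unfolding eigenvalue_def by blast
    qed
    show "filterlim (\<lambda>x. f x - x) at_infinity at_infinity"
    proof (rule filterlim_mpoly_map_minus_id_at_infinity[OF assms(1)])
      show "1 < total_degree (p i)" for i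
        using assms(3)[of i] total_degree_leading_form_le[of "p i"] by linarith
    qed (use assms(4) in blast)
  qed
  then have "\<exists>!x. f x - x = 0"
    unfolding bij_iff by (rule spec)
  then show ?thesis by simp
qed

end
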